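(* Let $K$ be a skew field and let $X$ be a set on which the multiplicative group $K^*=K\setminus\{0\}$ acts on the left. Equipped with pointwise addition and the left skew product $\diamond$, the set $\mathcal{S}(X)$ of all skew-convex functions $f\colon X\to K$ is a ring with identity.
   Context: The action of $a\in K^*$ on $x\in X$ is denoted ${}^{a}x$. For functions $f,g\colon X\to K$, the left skew product is $(f\diamond g)(x)=f({}^{g(x)}x)\,g(x)$ if $g(x)\neq0$ and $(f\diamond g)(x)=0$ if $g(x)=0$. A constant function with value $a\in K$ is denoted by $a$. A function $f\colon X\to K$ is skew convex if $f\diamond(a+b)=f\diamond a+f\diamond b$ for all $a,b\in K$ (constant functions). *)

theory Defs
  imports "HOL-Algebra.Multiplicative_Group" "HOL-Algebra.Group_Action"
begin

locale skew_field = ring K for K (structure) +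
  assumes skew_field_Units: "Units K = carrier K - {\<zero>}"

text \<open>
  A function from X to K is an element of \<^term>\<open>X \<rightarrow>\<^sub>E carrier K\<close>, i.e. it takes the value
  \<^term>\<open>undefined\<close> outside X, so that equality of such functions is equality on X.
  A left action of the multiplicative group \<^term>\<open>mult_of K\<close> on X is given by a map \<open>\<phi>\<close> with
  \<^term>\<open>group_action (mult_of K) X \<phi>\<close>; the result of a acting on x is \<^term>\<open>\<phi> a x\<close>.
\<close>

definition fun_add :: "('k, 'm) ring_scheme \<Rightarrow> 'x set \<Rightarrow> ('x \<Rightarrow> 'k) \<Rightarrow> ('x \<Rightarrow> 'k) \<Rightarrow> 'x \<Rightarrow> 'k"
  where "fun_add K X f g = (\<lambda>x\<in>X. f x \<oplus>\<^bsub>K\<^esub> g x)"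

definition const_fun :: "'x set \<Rightarrow> 'k \<Rightarrow> 'x \<Rightarrow> 'k"
  where "const_fun X a = (\<lambda>x\<in>X. a)"

definition skew_prod ::
    "('k, 'm) ring_scheme \<Rightarrow> 'x set \<Rightarrow> ('k \<Rightarrow> 'x \<Rightarrow> 'x) \<Rightarrow> ('x \<Rightarrow> 'k) \<Rightarrow> ('x \<Rightarrow> 'k) \<Rightarrow> 'x \<Rightarrow> 'k"
  where "skew_prod K X \<phi> f g =
    (\<lambda>x\<in>X. if g x = \<zero>\<^bsub>K\<^esub> then \<zero>\<^bsub>K\<^esub> else f (\<phi> (g x) x) \<otimes>\<^bsub>K\<^esub> g x)"

definition skew_convex :: "('k, 'm) ring_scheme \<Rightarrow> 'x set \<Rightarrow> ('k \<Rightarrow> 'x \<Rightarrow> 'x) \<Rightarrow> ('x \<Rightarrow> 'k) \<Rightarrow> bool"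
  where "skew_convex K X \<phi> f \<longleftrightarrow>
    (\<forall>a\<in>carrier K. \<forall>b\<in>carrier K.
      skew_prod K X \<phi> f (const_fun X (a \<oplus>\<^bsub>K\<^esub> b)) =
        fun_add K X (skew_prod K X \<phi> f (const_fun X a)) (skew_prod K X \<phi> f (const_fun X b)))"

definition skew_convex_ring :: "('k, 'm) ring_scheme \<Rightarrow> 'x set \<Rightarrow> ('k \<Rightarrow> 'x \<Rightarrow> 'x) \<Rightarrow> ('x \<Rightarrow> 'k) ring"
  where "skew_convex_ring K X \<phi> =
    \<lparr> carrier = {f \<in> X \<rightarrow>\<^sub>E carrier K. skew_convex K X \<phi> f},
      mult = skew_prod K X \<phi>,
      one = const_fun X \<one>\<^bsub>K\<^esub>,
      zero = const_fun X \<zero>\<^bsub>K\<^esub>,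
      add = fun_add K X \<rparr>"

end

theory Submission
  imports Defs
begin

text \<open>
  Extend f homogeneously along orbits: the map sending a to the value of f \<open>\<diamond>\<close> a at x is an operator
  on K (\<open>extension f x\<close> below). Then f is skew convex iff all its operators are additive,
  f \<open>\<diamond>\<close> g at x is the operator of f applied to g x, and the operator of f \<open>\<diamond>\<close> g is the composite of
  those of f and g. So the ring axioms become those of additive endomorphisms of K.
\<close>

locale skew_field_action = skew_field K + group_action "mult_of K" X \<phi>
  for K :: "('k, 'm) ring_scheme" (structure)
    and X :: "'x set" and \<phi> :: "'k \<Rightarrow> 'x \<Rightarrow> 'x"
begin

text \<open>The value 0 at 0 matches the zero clause of \<open>skew_prod\<close>, so the product is
  evaluation of this operator in every case. Additivity would force the same value.\<close>

definition extension :: "('x \<Rightarrow> 'k) \<Rightarrow> 'x \<Rightarrow> 'k \<Rightarrow> 'k"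
  where "extension f x a = (if a = \<zero> then \<zero> else f (\<phi> a x) \<otimes> a)"

lemma value_closed: "\<lbrakk>f \<in> X \<rightarrow>\<^sub>E carrier K; x \<in> X\<rbrakk> \<Longrightarrow> f x \<in> carrier K"
  by (rule PiE_mem)

lemma fun_eqI:
  assumes "f \<in> X \<rightarrow>\<^sub>E carrier K" "g \<in> X \<rightarrow>\<^sub>E carrier K" "\<And>x. x \<in> X \<Longrightarrow> f x = g x"
  shows "f = g"
  using assms by (rule PiE_ext)

lemma action_closed: "\<lbrakk>a \<in> carrier K; a \<noteq> \<zero>; x \<in> X\<rbrakk> \<Longrightarrow> \<phi> a x \<in> X"
  by (rule element_image[of a]) simp_all

lemma one_not_zero: "\<one> \<noteq> \<zero>"
  using skew_field_Units Units_one_closed by auto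

text \<open>Nonzero elements are units, and units are closed under products. This keeps
  \<open>b \<otimes> a\<close> out of the zero clause of \<open>extension\<close>.\<close>

lemma mult_not_zero:
  assumes "a \<in> carrier K" "a \<noteq> \<zero>" "b \<in> carrier K" "b \<noteq> \<zero>"
  shows "a \<otimes> b \<noteq> \<zero>"
  using assms skew_field_Units Units_m_closed[of a b] by auto

lemma action_one: "x \<in> X \<Longrightarrow> \<phi> \<one> x = x"
  using id_eq_one by (metis one_mult_of restrict_apply')

lemma action_mult:
  assumes "a \<in> carrier K" "a \<noteq> \<zero>" "b \<in> carrier K" "b \<noteq> \<zero>" "x \<in> X"
  shows "\<phi> (a \<otimes> b) x = \<phi> a (\<phi> b x)"
  using composition_rule[of x a b] assms by simp

lemma extension_closed:
  assumes "f \<in> X \<rightarrow>\<^sub>E carrier K" "x \<in> X" "a \<in> carrier K"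
  shows "extension f x a \<in> carrier K"
  using assms action_closed by (auto simp: extension_def value_closed)

lemma extension_zero [simp]: "extension f x \<zero> = \<zero>"
  by (simp add: extension_def)

text \<open>The identity of the group acts trivially, so evaluating the operator at
  \<open>\<one>\<close> recovers f. This makes the constant \<open>\<one>\<close> a right
  identity.\<close>

lemma extension_one:
  assumes "f \<in> X \<rightarrow>\<^sub>E carrier K" "x \<in> X"
  shows "extension f x \<one> = f x"
  using assms by (simp add: extension_def one_not_zero action_one value_closed)

text \<open>Moving the base point along its orbit amounts to multiplying the argument on the right:
  for nonzero b the action law turns both sides into
  \<open>f (\<phi> (b \<otimes> a) x) \<otimes> (b \<otimes> a)\<close>. Composition of operators
  rests on this identity.\<close>

lemma extension_action:
  assumes "f \<in> X \<rightarrow>\<^sub>E carrier K" "x \<in> X" "a \<in> carrier K" "a \<noteq> \<zero>" "b \<in> carrier K"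
  shows "extension f (\<phi> a x) b \<otimes> a = extension f x (b \<otimes> a)"
proof (cases "b = \<zero>")
  case False
  have "f (\<phi> b (\<phi> a x)) \<in> carrier K"
    using assms False action_closed by (auto intro: value_closed)
  then show ?thesis
    using assms False by (simp add: extension_def mult_not_zero action_mult m_assoc)
qed (use assms in simp)

lemma skew_prod_apply: "x \<in> X \<Longrightarrow> skew_prod K X \<phi> f g x = extension f x (g x)"
  by (simp add: skew_prod_def extension_def)

lemma fun_add_closed:
  "\<lbrakk>f \<in> X \<rightarrow>\<^sub>E carrier K; g \<in> X \<rightarrow>\<^sub>E carrier K\<rbrakk> \<Longrightarrow> fun_add K X f g \<in> X \<rightarrow>\<^sub>E carrier K"
  by (auto simp: fun_add_def PiE_iff)

lemma const_fun_closed: "a \<in> carrier K \<Longrightarrow> const_fun X a \<in> X \<rightarrow>\<^sub>E carrier K"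
  by (auto simp: const_fun_def)

lemma skew_prod_closed:
  assumes "f \<in> X \<rightarrow>\<^sub>E carrier K" "g \<in> X \<rightarrow>\<^sub>E carrier K"
  shows "skew_prod K X \<phi> f g \<in> X \<rightarrow>\<^sub>E carrier K"
proof (rule PiE_I)
  show "skew_prod K X \<phi> f g x \<in> carrier K" if "x \<in> X" for x
    using assms that by (simp add: skew_prod_apply extension_closed value_closed)
qed (simp add: skew_prod_def)

text \<open>The product of f with the constant c lists, over all x in X, the values at c of the
  operators of f; comparing such functions pointwise gives additivity.\<close>

lemma skew_convex_iff:
  "skew_convex K X \<phi> f \<longleftrightarrow>
    (\<forall>x\<in>X. \<forall>a\<in>carrier K. \<forall>b\<in>carrier K.
      extension f x (a \<oplus> b) = extension f x a \<oplus> extension f x b)"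
proof -
  have "skew_prod K X \<phi> f (const_fun X c) = (\<lambda>x\<in>X. extension f x c)" for c
    by (auto simp: skew_prod_def const_fun_def extension_def)
  then show ?thesis
    by (auto simp: skew_convex_def fun_add_def fun_eq_iff restrict_def)
qed

lemma extension_fun_add:
  assumes "f \<in> X \<rightarrow>\<^sub>E carrier K" "g \<in> X \<rightarrow>\<^sub>E carrier K" "x \<in> X" "a \<in> carrier K"
  shows "extension (fun_add K X f g) x a = extension f x a \<oplus> extension g x a"
  using assms action_closed[of a x]
  by (auto simp: extension_def fun_add_def l_distr value_closed)

text \<open>A constant does not see the orbit, so its operator is left multiplication by c.\<close>

lemma extension_const_fun:
  assumes "x \<in> X" "a \<in> carrier K" "c \<in> carrier K"
  shows "extension (const_fun X c) x a = c \<otimes> a"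
  using assms action_closed by (simp add: extension_def const_fun_def)

lemma extension_skew_prod:
  assumes "f \<in> X \<rightarrow>\<^sub>E carrier K" "g \<in> X \<rightarrow>\<^sub>E carrier K" "x \<in> X" "a \<in> carrier K"
  shows "extension (skew_prod K X \<phi> f g) x a = extension f x (extension g x a)"
proof (cases "a = \<zero>")
  case False
  have "\<phi> a x \<in> X"
    using assms False action_closed by blast
  then show ?thesis
    \<comment> \<open>With y for \<open>\<phi> a x\<close>, the left side is
      \<open>extension f y (g y) \<otimes> a\<close>. Taking b as \<open>g y\<close> moves the base
      point back to x, and \<open>g y \<otimes> a\<close> is \<open>extension g x a\<close>. The
      operator of f stays folded, so \<open>g y = \<zero>\<close> needs no separate case.\<close>
    using assms False extension_action[of f x a "g (\<phi> a x)"]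
    by (simp add: extension_def[of "skew_prod K X \<phi> f g"] extension_def[of g]
        skew_prod_apply value_closed)
qed simp

lemma skew_convexD:
  assumes "skew_convex K X \<phi> f" "x \<in> X" "a \<in> carrier K" "b \<in> carrier K"
  shows "extension f x (a \<oplus> b) = extension f x a \<oplus> extension f x b"
  using assms by (simp add: skew_convex_iff)

text \<open>Left multiplication is additive by distributivity. This supplies the zero, the identity
  and the constant \<open>\<ominus> \<one>\<close>.\<close>

lemma skew_convex_const_fun: "c \<in> carrier K \<Longrightarrow> skew_convex K X \<phi> (const_fun X c)"
  by (simp add: skew_convex_iff extension_const_fun r_distr)

lemma skew_convex_fun_add:
  assumes "f \<in> X \<rightarrow>\<^sub>E carrier K" "g \<in> X \<rightarrow>\<^sub>E carrier K"
    and "skew_convex K X \<phi> f" "skew_convex K X \<phi> g"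
  shows "skew_convex K X \<phi> (fun_add K X f g)"
  using assms
  by (simp add: skew_convex_iff extension_fun_add extension_closed add.m_assoc add.m_lcomm)

text \<open>A composite of additive maps is additive.\<close>

lemma skew_convex_skew_prod:
  assumes "f \<in> X \<rightarrow>\<^sub>E carrier K" "g \<in> X \<rightarrow>\<^sub>E carrier K"
    and "skew_convex K X \<phi> f" "skew_convex K X \<phi> g"
  shows "skew_convex K X \<phi> (skew_prod K X \<phi> f g)"
  using assms by (simp add: skew_convex_iff extension_skew_prod extension_closed)

text \<open>At x both sides apply the operator of g to \<open>h x\<close> and then the operator of
  f.\<close>

lemma skew_prod_assoc:
  assumes "f \<in> X \<rightarrow>\<^sub>E carrier K" "g \<in> X \<rightarrow>\<^sub>E carrier K" "h \<in> X \<rightarrow>\<^sub>E carrier K"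
  shows "skew_prod K X \<phi> (skew_prod K X \<phi> f g) h = skew_prod K X \<phi> f (skew_prod K X \<phi> g h)"
proof (rule fun_eqI)
  show "skew_prod K X \<phi> (skew_prod K X \<phi> f g) h x = skew_prod K X \<phi> f (skew_prod K X \<phi> g h) x"
    if "x \<in> X" for x
    using assms that by (simp add: skew_prod_apply extension_skew_prod value_closed)
qed (intro skew_prod_closed assms)+

lemma skew_prod_one_left:
  assumes "f \<in> X \<rightarrow>\<^sub>E carrier K"
  shows "skew_prod K X \<phi> (const_fun X \<one>) f = f"
proof (rule fun_eqI)
  show "skew_prod K X \<phi> (const_fun X \<one>) f x = f x" if "x \<in> X" for x
    using assms that by (simp add: skew_prod_apply extension_const_fun value_closed)
qed (intro skew_prod_closed const_fun_closed one_closed assms)+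

lemma skew_prod_one_right:
  assumes "f \<in> X \<rightarrow>\<^sub>E carrier K"
  shows "skew_prod K X \<phi> f (const_fun X \<one>) = f"
proof (rule fun_eqI)
  show "skew_prod K X \<phi> f (const_fun X \<one>) x = f x" if "x \<in> X" for x
    using assms that by (simp add: skew_prod_apply const_fun_def extension_one)
qed (intro skew_prod_closed const_fun_closed one_closed assms)+

lemma skew_prod_fun_add_left:
  assumes "f \<in> X \<rightarrow>\<^sub>E carrier K" "g \<in> X \<rightarrow>\<^sub>E carrier K" "h \<in> X \<rightarrow>\<^sub>E carrier K"
  shows "skew_prod K X \<phi> (fun_add K X f g) h =
    fun_add K X (skew_prod K X \<phi> f h) (skew_prod K X \<phi> g h)"
proof (rule fun_eqI)
  show "skew_prod K X \<phi> (fun_add K X f g) h x =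
      fun_add K X (skew_prod K X \<phi> f h) (skew_prod K X \<phi> g h) x" if "x \<in> X" for x
    using assms that
    \<comment> \<open>Only the outer sum is unfolded; the sum of f and g must stay folded for
      \<open>extension_fun_add\<close> to apply.\<close>
    by (simp add: skew_prod_apply extension_fun_add value_closed fun_add_def[of _ _ "skew_prod K X \<phi> f h"])
qed (intro skew_prod_closed fun_add_closed assms)+

text \<open>Here additivity of the operators of f enters: they are applied to
  \<open>g x \<oplus> h x\<close>.\<close>

lemma skew_prod_fun_add_right:
  assumes "f \<in> X \<rightarrow>\<^sub>E carrier K" "g \<in> X \<rightarrow>\<^sub>E carrier K" "h \<in> X \<rightarrow>\<^sub>E carrier K"
    and "skew_convex K X \<phi> f"
  shows "skew_prod K X \<phi> f (fun_add K X g h) =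
    fun_add K X (skew_prod K X \<phi> f g) (skew_prod K X \<phi> f h)"
proof (rule fun_eqI)
  show "skew_prod K X \<phi> f (fun_add K X g h) x =
      fun_add K X (skew_prod K X \<phi> f g) (skew_prod K X \<phi> f h) x" if "x \<in> X" for x
    using assms that by (simp add: skew_prod_apply fun_add_def skew_convexD value_closed)
qed (intro skew_prod_closed fun_add_closed assms)+

text \<open>Writing the negative of f as a product with the constant \<open>\<ominus> \<one>\<close>
  lets its skew convexity follow from closure under products.\<close>

lemma fun_add_left_inverse:
  assumes "f \<in> X \<rightarrow>\<^sub>E carrier K"
  shows "fun_add K X (skew_prod K X \<phi> (const_fun X (\<ominus> \<one>)) f) f = const_fun X \<zero>"
proof (rule fun_eqI)
  show "fun_add K X (skew_prod K X \<phi> (const_fun X (\<ominus> \<one>)) f) f x = const_fun X \<zero> x"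
    if "x \<in> X" for x
    using assms that
    \<comment> \<open>Constants are unfolded only in the second call, since
      \<open>extension_const_fun\<close> has to match them first.\<close>
    by (simp add: fun_add_def skew_prod_apply extension_const_fun value_closed l_minus l_neg)
      (simp add: const_fun_def)
qed (intro skew_prod_closed fun_add_closed const_fun_closed a_inv_closed one_closed zero_closed assms)+

lemma fun_add_assoc:
  assumes "f \<in> X \<rightarrow>\<^sub>E carrier K" "g \<in> X \<rightarrow>\<^sub>E carrier K" "h \<in> X \<rightarrow>\<^sub>E carrier K"
  shows "fun_add K X (fun_add K X f g) h = fun_add K X f (fun_add K X g h)"
  using assms by (auto simp: fun_add_def value_closed a_assoc intro!: restrict_ext)

lemma fun_add_comm:
  assumes "f \<in> X \<rightarrow>\<^sub>E carrier K" "g \<in> X \<rightarrow>\<^sub>E carrier K"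
  shows "fun_add K X f g = fun_add K X g f"
  using assms by (auto simp: fun_add_def value_closed a_comm intro!: restrict_ext)

lemma fun_add_zero_left:
  assumes "f \<in> X \<rightarrow>\<^sub>E carrier K"
  shows "fun_add K X (const_fun X \<zero>) f = f"
proof (rule fun_eqI)
  show "fun_add K X (const_fun X \<zero>) f x = f x" if "x \<in> X" for x
    using assms that by (simp add: fun_add_def const_fun_def value_closed)
qed (intro fun_add_closed const_fun_closed zero_closed assms)+

lemma ring_skew_convex_ring: "ring (skew_convex_ring K X \<phi>)"
proof (rule ringI)
  show "abelian_group (skew_convex_ring K X \<phi>)"
  proof (rule abelian_groupI)
    fix f assume f: "f \<in> carrier (skew_convex_ring K X \<phi>)"
    show "\<exists>g\<in>carrier (skew_convex_ring K X \<phi>).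
        g \<oplus>\<^bsub>skew_convex_ring K X \<phi>\<^esub> f = \<zero>\<^bsub>skew_convex_ring K X \<phi>\<^esub>"
      using f
      by (intro bexI[of _ "skew_prod K X \<phi> (const_fun X (\<ominus> \<one>)) f"])
        (simp_all add: skew_convex_ring_def fun_add_left_inverse skew_prod_closed
          skew_convex_skew_prod const_fun_closed skew_convex_const_fun)
  qed (auto simp: skew_convex_ring_def fun_add_closed skew_convex_fun_add fun_add_assoc
      fun_add_zero_left const_fun_closed skew_convex_const_fun intro: fun_add_comm)
  show "monoid (skew_convex_ring K X \<phi>)"
    by (rule monoidI)
      (simp_all add: skew_convex_ring_def skew_prod_closed skew_convex_skew_prod skew_prod_assoc
        skew_prod_one_left skew_prod_one_right const_fun_closed skew_convex_const_fun)
qed (simp_all add: skew_convex_ring_def skew_prod_fun_add_left skew_prod_fun_add_right)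

end

theorem theorem2p4:
  fixes K :: "('k, 'm) ring_scheme"
    and X :: "'x set"
    and \<phi> :: "'k \<Rightarrow> 'x \<Rightarrow> 'x"
  assumes "skew_field K"
    and "group_action (mult_of K) X \<phi>"
  shows "ring (skew_convex_ring K X \<phi>)"
proof -
  interpret skew_field_action K X \<phi>
    by (intro skew_field_action.intro assms)
  show ?thesis
    by (rule ring_skew_convex_ring)
qed

end
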